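(* Let $N\ge1$. A bijection $R:[N]^2\to[N]^2$ is a solution of the Yang–Baxter equation on $[N]$ if and only if, for every integer $n\ge 1$, its $n$th level $R^{n,n}$ is a solution of the Yang–Baxter equation on $[N]^n$. Furthermore: (i) if $R$ is involutive, then so is $R^{n,n}$ for every $n\ge1$; (ii) if $R$ is of derived type, then so is $R^{n,n}$ for every $n\ge 1$.
   Context: $[N]=\{1,\dots,N\}$. A bijection $R:X^2\to X^2$ is a (set-theoretic) solution of the Yang–Baxter equation (YBE solution) on $X$ if $R_{12}R_{23}R_{12}=R_{23}R_{12}R_{23}$ on $X^3$, where $R_{12}=R\times \mathrm{id}_X$ and $R_{23}=\mathrm{id}_X\times R$. It is involutive if $R^2=\mathrm{id}_{X^2}$. A YBE solution on $X$ is of derived type if it has one of the forms $R(x,y)=(\beta_x(y),x)$ for all $x,y$, or $R(x,y)=(y,\beta_y(x))$ for all $x,y$, for some maps $\beta_x:X\to X$ ($x\in X$). Higher levels: identify $[N]^n$ (written $[N^n]$ in the paper) with the set of words of length $n$ in the alphabet $[N]$. For a bijection $R$ on $[N]^2$, words $u$ of length $l$ and $v$ of length $m$, define $R^{l,m}(u,v)=(v',u')$ (with $|v'|=m$, $|u'|=l$) by moving $u$ past $v$ letter by letter using $R$, i.e. by $e^1_ue^2_v=e^2_{v'}e^1_{u'}$ in the unital semigroup generated by $e^1_{\mathfrak s},e^2_{\mathfrak s}$ ($\mathfrak s\in[N]$) subject to $e^1_{\mathfrak s}e^2_{\mathfrak t}=e^2_{\mathfrak t'}e^1_{\mathfrak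 s'}$ whenever $R(\mathfrak s,\mathfrak t)=(\mathfrak t',\mathfrak s')$, where $e^i_u=e^i_{\mathfrak s_1}\cdots e^i_{\mathfrak s_l}$ for $u=\mathfrak s_1\cdots\mathfrak s_l$. Explicitly, identifying $[N]^n\times[N]^n$ with $[N]^{2n}$ by concatenation, $$R^{n,n}=(R_{n,n+1}\cdots R_{12})(R_{n+1,n+2}\cdots R_{23})\cdots(R_{2n-1,2n}\cdots R_{n,n+1}),$$ where $R_{i,i+1}$ applies $R$ to the coordinates $i,i+1$ and fixes the other coordinates, and products denote composition of maps (rightmost applied first). *)

theory Defs
  imports Main "HOL-Library.FuncSet" "HOL-Library.NList"
begin

text \<open>A map on \<open>X \<times> X\<close> is a total function on the ambient type of which only the values on the
  carrier \<open>X \<times> X\<close> matter.  Elements of \<open>X\<^sup>3\<close> are right-nested triples, so \<open>id \<times> R\<close> is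
  \<^term>\<open>map_prod id R\<close>, whereas \<open>R \<times> id\<close> has to reassociate.\<close>

definition R12 :: "('a \<times> 'a \<Rightarrow> 'a \<times> 'a) \<Rightarrow> 'a \<times> 'a \<times> 'a \<Rightarrow> 'a \<times> 'a \<times> 'a" where
  "R12 R = (\<lambda>(x, y, z). case R (x, y) of (a, b) \<Rightarrow> (a, b, z))"

definition R23 :: "('a \<times> 'a \<Rightarrow> 'a \<times> 'a) \<Rightarrow> 'a \<times> 'a \<times> 'a \<Rightarrow> 'a \<times> 'a \<times> 'a" where
  "R23 R = map_prod id R"

definition YBE_solution :: "'a set \<Rightarrow> ('a \<times> 'a \<Rightarrow> 'a \<times> 'a) \<Rightarrow> bool" where
  "YBE_solution X R \<longleftrightarrow>
     bij_betw R (X \<times> X) (X \<times> X) \<and>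
     (\<forall>t \<in> X \<times> X \<times> X. (R12 R \<circ> R23 R \<circ> R12 R) t = (R23 R \<circ> R12 R \<circ> R23 R) t)"

definition involutive_on :: "'a set \<Rightarrow> ('a \<times> 'a \<Rightarrow> 'a \<times> 'a) \<Rightarrow> bool" where
  "involutive_on X R \<longleftrightarrow> (\<forall>p \<in> X \<times> X. R (R p) = p)"

definition derived_type :: "'a set \<Rightarrow> ('a \<times> 'a \<Rightarrow> 'a \<times> 'a) \<Rightarrow> bool" where
  "derived_type X R \<longleftrightarrow>
     YBE_solution X R \<and>
     (\<exists>\<beta> \<in> X \<rightarrow> X \<rightarrow> X.
        (\<forall>x\<in>X. \<forall>y\<in>X. R (x, y) = (\<beta> x y, x)) \<or>
        (\<forall>x\<in>X. \<forall>y\<in>X. R (x, y) = (y, \<beta> y x)))"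

text \<open>\<open>adj R i\<close> is \<open>R\<^sub>i\<^sub>,\<^sub>i\<^sub>+\<^sub>1\<close> on words.  Coordinates are counted from 1 (\<open>1 \<le> i < length w\<close>),
  while list positions start at 0.\<close>

definition adj :: "('a \<times> 'a \<Rightarrow> 'a \<times> 'a) \<Rightarrow> nat \<Rightarrow> 'a list \<Rightarrow> 'a list" where
  "adj R i w = (case R (w ! (i - 1), w ! i) of (a, b) \<Rightarrow> w[i - 1 := a, i := b])"

definition comp_list :: "('b \<Rightarrow> 'b) list \<Rightarrow> 'b \<Rightarrow> 'b" where
  "comp_list fs = foldr (\<circ>) fs id"

text \<open>\<open>level_factor R n k\<close> is the \<open>k\<close>-th bracket \<open>R\<^sub>n\<^sub>+\<^sub>k\<^sub>-\<^sub>1\<^sub>,\<^sub>n\<^sub>+\<^sub>k \<cdots> R\<^sub>k\<^sub>,\<^sub>k\<^sub>+\<^sub>1\<close> of the product defining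
  \<open>R\<^sup>n\<^sup>,\<^sup>n\<close>; it moves the \<open>k\<close>-th letter of \<open>u\<close> past a word of length \<open>n\<close>.\<close>

definition level_factor :: "('a \<times> 'a \<Rightarrow> 'a \<times> 'a) \<Rightarrow> nat \<Rightarrow> nat \<Rightarrow> 'a list \<Rightarrow> 'a list" where
  "level_factor R n k = comp_list (map (adj R) (rev [k..<n + k]))"

text \<open>\<open>level R n\<close> is \<open>R\<^sup>n\<^sup>,\<^sup>n\<close>; pairs of words of length \<open>n\<close> are identified with words of
  length \<open>2n\<close> by concatenation.\<close>

definition level ::
    "('a \<times> 'a \<Rightarrow> 'a \<times> 'a) \<Rightarrow> nat \<Rightarrow> 'a list \<times> 'a list \<Rightarrow> 'a list \<times> 'a list" where
  "level R n = (\<lambda>(u, v).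
     let w = comp_list (map (level_factor R n) [1..<Suc n]) (u @ v) in (take n w, drop n w))"

end

theory Submission imports Defs begin

text \<open>
  The map \<^term>\<open>level R n\<close> is a wiring diagram: a bundle of \<open>n\<close> strands labelled by the letters of
  \<open>u\<close> crosses a bundle of \<open>n\<close> strands labelled by the letters of \<open>v\<close>, and \<open>R\<close> is
  applied at each of the \<open>n\<^sup>2\<close> crossings.  It is convenient to let the two bundles have
  different sizes; the resulting map on pairs of words is called \<open>pass R\<close>.  Then a bundle may be
  cut anywhere: crossing a concatenation of two words is the same as crossing them one after the
  other (\<open>pass_append_left\<close>, \<open>pass_append_right\<close>).

  All assertions follow by cutting until only single letters remain.  Reading the
  diagram backwards with \<open>R\<^sup>-\<^sup>1\<close> at each crossing undoes it, which gives bijectivity and, when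
  \<open>R\<^sup>-\<^sup>1 = R\<close>, involutivity.  If no crossing changes the letter that moves to the right, or
  none changes the letter that moves to the left, the same is true of bundles, which is the
  statement on derived type.  Finally, the two sides of the braid relation are the two ways of
  crossing three bundles; if one of the bundles is cut in two, the relation for it is the composite
  of the relations for its two parts, so the relation for letters implies that for words, by
  induction on the total number of strands (\<open>braid_at_pass\<close>).  Conversely level 1 is \<open>R\<close> itself.
\<close>

text \<open>As rewrite rules these two have a variable that occurs only in the premise, which makes the
  simplifier search for membership facts whenever it meets the length or the letters of a word.\<close>

declare nlistsE_length [simp del] nlistsE_set [simp del]

section \<open>Moving one word past another\<close>

fun move :: "('a \<times> 'a \<Rightarrow> 'a \<times> 'a) \<Rightarrow> 'a \<Rightarrow> 'a list \<Rightarrow> 'a list \<times> 'a" where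
  "move R x [] = ([], x)"
| "move R x (y # v) =
     (case R (x, y) of (y', x') \<Rightarrow> case move R x' v of (v', x'') \<Rightarrow> (y' # v', x''))"

text \<open>This is \<open>R\<^sup>l\<^sup>,\<^sup>m\<close> for all word lengths \<open>l\<close> and \<open>m\<close> at once; the letter of \<open>u\<close> next to \<open>v\<close>,
  that is the last one, has to move first.\<close>

fun pass :: "('a \<times> 'a \<Rightarrow> 'a \<times> 'a) \<Rightarrow> 'a list \<times> 'a list \<Rightarrow> 'a list \<times> 'a list" where
  "pass R ([], v) = (v, [])"
| "pass R (x # u, v) =
     (case pass R (u, v) of (v', u') \<Rightarrow> case move R x v' of (v'', x') \<Rightarrow> (v'', x' # u'))"

lemma pass_Nil_right [simp]: "pass R (u, []) = ([], u)"
  by (induction u) auto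

lemma pass_singletons: "pass R ([x], [y]) = map_prod (\<lambda>a. [a]) (\<lambda>a. [a]) (R (x, y))"
  by (simp split: prod.split)

lemma pass_append_left:
  assumes "pass R (u2, v) = (v1, u2')" "pass R (u1, v1) = (v2, u1')"
  shows "pass R (u1 @ u2, v) = (v2, u1' @ u2')"
  using assms(2) by (induction u1 arbitrary: v2 u1') (auto simp: assms(1) split: prod.splits)

lemma move_append:
  assumes "move R x v1 = (v1', x')" "move R x' v2 = (v2', x'')"
  shows "move R x (v1 @ v2) = (v1' @ v2', x'')"
  using assms by (induction v1 arbitrary: x v1') (auto split: prod.splits)

lemma pass_append_right:
  assumes "pass R (u, v1) = (v1', u')" "pass R (u', v2) = (v2', u'')"
  shows "pass R (u, v1 @ v2) = (v1' @ v2', u'')"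
  using assms
proof (induction u arbitrary: v1' v2' u' u'')
  case (Cons x u)
  obtain a u1 where 1: "pass R (u, v1) = (a, u1)" by force
  with Cons.prems(1) obtain x1 where 2: "move R x a = (v1', x1)" "u' = x1 # u1"
    by (auto split: prod.splits)
  obtain b u2 where 3: "pass R (u1, v2) = (b, u2)" by force
  with Cons.prems(2) 2 obtain x2 where 4: "move R x1 b = (v2', x2)" "u'' = x2 # u2"
    by (auto split: prod.splits)
  show ?case
    using Cons.IH[OF 1 3] move_append[OF 2(1) 4(1)] 4(2) by simp
qed simp

text \<open>A diagram is built from letter crossings by cutting bundles, so a property of crossings that
  is preserved by both ways of cutting need only be checked on letters.\<close>

lemma pass_induct [consumes 4, case_names Nil_left Nil_right letters left right]:
  assumes "pass R (u, v) = (v', u')"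
    and "R \<in> X \<times> X \<rightarrow> X \<times> X" "u \<in> lists X" "v \<in> lists X"
    and Nil_left: "\<And>v. v \<in> lists X \<Longrightarrow> Q [] v v []"
    and Nil_right: "\<And>u. u \<in> lists X \<Longrightarrow> Q u [] [] u"
    and letters: "\<And>x y y' x'. x \<in> X \<Longrightarrow> y \<in> X \<Longrightarrow> y' \<in> X \<Longrightarrow> x' \<in> X \<Longrightarrow> R (x, y) = (y', x')
        \<Longrightarrow> Q [x] [y] [y'] [x']"
    and left: "\<And>u1 u2 v v1 v2 u1' u2'. Q u2 v v1 u2' \<Longrightarrow> Q u1 v1 v2 u1'
        \<Longrightarrow> Q (u1 @ u2) v v2 (u1' @ u2')"
    and right: "\<And>u v1 v2 v1' v2' u' u''. Q u v1 v1' u' \<Longrightarrow> Q u' v2 v2' u''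
        \<Longrightarrow> Q u (v1 @ v2) (v1' @ v2') u''"
  shows "Q u v v' u'"
proof -
  have move: "case move R x v of (v', x') \<Rightarrow> Q [x] v v' [x'] \<and> v' \<in> lists X \<and> x' \<in> X"
    if "x \<in> X" "v \<in> lists X" for x v
    using that
  proof (induction v arbitrary: x)
    case Nil
    then show ?case using Nil_right by simp
  next
    case (Cons y v)
    obtain y' x' where R: "R (x, y) = (y', x')" by force
    obtain v' x'' where m: "move R x' v = (v', x'')" by force
    have X: "y' \<in> X" "x' \<in> X"
      using funcset_mem[OF assms(2), of "(x, y)"] Cons.prems R by simp_all
    have "Q [x] [y] [y'] [x']"
      using Cons.prems X R by (intro letters) simp_all
    moreover have IH: "Q [x'] v v' [x'']" "v' \<in> lists X" "x'' \<in> X"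
      using Cons.IH[of x'] Cons.prems X m by simp_all
    ultimately have "Q [x] ([y] @ v) ([y'] @ v') [x'']"
      by (intro right)
    then show ?case
      using X IH R m by simp
  qed
  have "case pass R (u, v) of (v', u') \<Rightarrow> Q u v v' u' \<and> v' \<in> lists X"
    using assms(3)
  proof (induction u rule: list.induct)
    case Nil
    then show ?case using Nil_left assms(4) by simp
  next
    case (Cons x u)
    obtain v' u' where p: "pass R (u, v) = (v', u')" by force
    obtain v'' x' where m: "move R x v' = (v'', x')" by force
    have IH: "Q u v v' u'" "v' \<in> lists X"
      using Cons p by auto
    have "Q [x] v' v'' [x'] \<and> v'' \<in> lists X"
      using move[of x v'] Cons.prems IH m by auto
    with left[OF IH(1), of "[x]" v'' "[x']"] show ?case
      using p m by simp
  qed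
  with assms(1) show ?thesis by simp
qed

lemma nlists_imp_lists: "u \<in> nlists n X \<Longrightarrow> u \<in> lists X"
  by (auto simp: nlists_def)

lemma pass_nlists:
  assumes "R \<in> X \<times> X \<rightarrow> X \<times> X" "u \<in> nlists m X" "v \<in> nlists n X" "pass R (u, v) = (v', u')"
  shows "v' \<in> nlists n X" "u' \<in> nlists m X"
proof -
  have "u \<in> lists X" "v \<in> lists X"
    using assms(2,3) by (simp_all add: nlists_imp_lists)
  with assms(4,1) have "v' \<in> lists X \<and> u' \<in> lists X \<and> length v' = length v \<and> length u' = length u"
    by (induction rule: pass_induct) simp_all
  then show "v' \<in> nlists n X" "u' \<in> nlists m X"
    using assms(2,3) by (auto simp: nlists_def)
qed

lemma pass_lengths:
  assumes "pass R (u, v) = (v', u')"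
  shows "length v' = length v" "length u' = length u"
  using pass_nlists[of R UNIV u "length u" v "length v", OF _ _ _ assms] by (simp_all add: nlists_def)

text \<open>With \<open>P = R\<close> this gives involutivity, and with \<open>P = R\<^sup>-\<^sup>1\<close> bijectivity.  Reading a diagram
  backwards exchanges the roles of its two bundles, hence of the two ways of cutting.\<close>

lemma pass_left_inverse:
  assumes "R \<in> X \<times> X \<rightarrow> X \<times> X" "\<And>p. p \<in> X \<times> X \<Longrightarrow> P (R p) = p"
    and "u \<in> lists X" "v \<in> lists X"
  shows "pass P (pass R (u, v)) = (u, v)"
proof -
  obtain v' u' where p: "pass R (u, v) = (v', u')" by force
  from this assms(1,3,4) have "pass P (v', u') = (u, v)"
  proof (induction rule: pass_induct)
    case (letters x y y' x')
    then show ?case using assms(2)[of "(x, y)"] by (simp add: pass_singletons)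
  qed (auto intro: pass_append_left pass_append_right)
  with p show ?thesis by simp
qed

lemma pass_keeps_left:
  assumes "R \<in> X \<times> X \<rightarrow> X \<times> X" "\<And>x y. x \<in> X \<Longrightarrow> y \<in> X \<Longrightarrow> snd (R (x, y)) = x"
    and "u \<in> lists X" "v \<in> lists X"
  shows "snd (pass R (u, v)) = u"
proof -
  obtain v' u' where p: "pass R (u, v) = (v', u')" by force
  from this assms(1,3,4) have "u' = u"
  proof (induction rule: pass_induct)
    case (letters x y y' x')
    then show ?case using assms(2)[of x y] by simp
  qed auto
  with p show ?thesis by simp
qed

lemma pass_keeps_right:
  assumes "R \<in> X \<times> X \<rightarrow> X \<times> X" "\<And>x y. x \<in> X \<Longrightarrow> y \<in> X \<Longrightarrow> fst (R (x, y)) = y"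
    and "u \<in> lists X" "v \<in> lists X"
  shows "fst (pass R (u, v)) = v"
proof -
  obtain v' u' where p: "pass R (u, v) = (v', u')" by force
  from this assms(1,3,4) have "v' = v"
  proof (induction rule: pass_induct)
    case (letters x y y' x')
    then show ?case using assms(2)[of x y] by simp
  qed auto
  with p show ?thesis by simp
qed

section \<open>The braid relation for words\<close>

definition braid_at :: "('a \<times> 'a \<Rightarrow> 'a \<times> 'a) \<Rightarrow> 'a \<Rightarrow> 'a \<Rightarrow> 'a \<Rightarrow> bool" where
  "braid_at T x y z \<longleftrightarrow>
     (R12 T \<circ> R23 T \<circ> R12 T) (x, y, z) = (R23 T \<circ> R12 T \<circ> R23 T) (x, y, z)"

lemma YBE_solution_iff_braid_at:
  "YBE_solution X R \<longleftrightarrow>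
     bij_betw R (X \<times> X) (X \<times> X) \<and> (\<forall>x\<in>X. \<forall>y\<in>X. \<forall>z\<in>X. braid_at R x y z)"
  by (auto simp: YBE_solution_def braid_at_def)

lemma braid_atI:
  assumes "T (x, y) = (y1, x1)" "T (x1, z) = (z1, x2)" "T (y1, z1) = (z2, y2)"
    and "T (y, z) = (za, ya)" "T (x, za) = (z2, xa)" "T (xa, ya) = (y2, x2)"
  shows "braid_at T x y z"
  using assms by (simp add: braid_at_def R12_def R23_def)

lemma braid_atE:
  assumes "braid_at T x y z"
    and "T (x, y) = (y1, x1)" "T (x1, z) = (z1, x2)" "T (y1, z1) = (z2, y2)"
  obtains za ya xa where "T (y, z) = (za, ya)" "T (x, za) = (z2, xa)" "T (xa, ya) = (y2, x2)"
proof -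
  obtain za ya where 1: "T (y, z) = (za, ya)" by force
  obtain zb xa where 2: "T (x, za) = (zb, xa)" by force
  obtain yb xb where 3: "T (xa, ya) = (yb, xb)" by force
  have "zb = z2" "yb = y2" "xb = x2"
    using assms 1 2 3 by (auto simp: braid_at_def R12_def R23_def)
  with 1 2 3 that show thesis by simp
qed

lemma braid_at_cong:
  assumes "T \<in> A \<times> A \<rightarrow> A \<times> A" "\<And>p. p \<in> A \<times> A \<Longrightarrow> T' p = T p"
    and "x \<in> A" "y \<in> A" "z \<in> A"
  shows "braid_at T' x y z \<longleftrightarrow> braid_at T x y z"
proof -
  have closed: "b \<in> A \<and> a \<in> A" if "T (x, y) = (b, a)" "x \<in> A" "y \<in> A" for x y a b
    using funcset_mem[OF assms(1), of "(x, y)"] that by simp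
  have eq: "T' (x, y) = T (x, y)" if "x \<in> A" "y \<in> A" for x y
    using assms(2) that by simp
  obtain y1 x1 where 1: "T (x, y) = (y1, x1)" by force
  obtain z1 x2 where 2: "T (x1, z) = (z1, x2)" by force
  obtain za ya where 3: "T (y, z) = (za, ya)" by force
  obtain zb xa where 4: "T (x, za) = (zb, xa)" by force
  have mem: "y1 \<in> A" "x1 \<in> A" "z1 \<in> A" "za \<in> A" "ya \<in> A" "xa \<in> A"
    using closed[OF 1] closed[OF 2] closed[OF 3] closed[OF 4] assms(3-5) by simp_all
  show ?thesis
    by (simp add: braid_at_def R12_def R23_def 1 2 3 4 eq mem assms(3-5))
qed

lemma braid_at_pass_singletons: "braid_at (pass R) [x] [y] [z] \<longleftrightarrow> braid_at R x y z"
  by (simp add: braid_at_def R12_def R23_def split: prod.split)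

text \<open>In each of the following three lemmas one of the three bundles is cut in two.  The braid move
  of the whole bundle is the move of one half followed by the move of the other half, where the
  second half meets the other two bundles after they have crossed the first.\<close>

lemma braid_at_append_left:
  assumes "braid_at (pass R) u2 v w"
    and "pass R (u2, v) = (v1, u2')" "pass R (u2', w) = (w1, u2'')"
    and "braid_at (pass R) u1 v1 w1"
  shows "braid_at (pass R) (u1 @ u2) v w"
proof -
  obtain wb vb where vw: "pass R (v1, w1) = (wb, vb)" by force
  obtain wa va U2 where 2: "pass R (v, w) = (wa, va)" "pass R (u2, wa) = (wb, U2)"
      "pass R (U2, va) = (vb, u2'')"
    using braid_atE[OF assms(1-3) vw] by metis
  obtain v2 u1' where a: "pass R (u1, v1) = (v2, u1')" by force
  obtain w2 u1'' where b: "pass R (u1', w1) = (w2, u1'')" by force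
  obtain w3 v3 where c: "pass R (v2, w2) = (w3, v3)" by force
  obtain U1 where 1: "pass R (u1, wb) = (w3, U1)" "pass R (U1, vb) = (v3, u1'')"
    using braid_atE[OF assms(4) a b c] vw by (metis prod.inject)
  show ?thesis
    by (rule braid_atI[OF pass_append_left[OF assms(2) a] pass_append_left[OF assms(3) b] c
          2(1) pass_append_left[OF 2(2) 1(1)] pass_append_left[OF 2(3) 1(2)]])
qed

lemma braid_at_append_middle:
  assumes "pass R (u, v1) = (v1', u')" "braid_at (pass R) u' v2 w"
    and "pass R (v2, w) = (wa, va)" "braid_at (pass R) u v1 wa"
  shows "braid_at (pass R) u (v1 @ v2) w"
proof -
  obtain v2' u'' where a: "pass R (u', v2) = (v2', u'')" by force
  obtain w1 U where b: "pass R (u'', w) = (w1, U)" by force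
  obtain w2 v2'' where c: "pass R (v2', w1) = (w2, v2'')" by force
  obtain w3 v1'' where d: "pass R (v1', w2) = (w3, v1'')" by force
  obtain ub where 2: "pass R (u', wa) = (w2, ub)" "pass R (ub, va) = (v2'', U)"
    using braid_atE[OF assms(2) a b c] assms(3) by (metis prod.inject)
  obtain wc vc uc where 1: "pass R (v1, wa) = (wc, vc)" "pass R (u, wc) = (w3, uc)"
      "pass R (uc, vc) = (v1'', ub)"
    using braid_atE[OF assms(4,1) 2(1) d] by metis
  show ?thesis
    by (rule braid_atI[OF pass_append_right[OF assms(1) a] b pass_append_left[OF c d]
          pass_append_left[OF assms(3) 1(1)] 1(2) pass_append_right[OF 1(3) 2(2)]])
qed

lemma braid_at_append_right:
  assumes "braid_at (pass R) u v w1"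
    and "pass R (v, w1) = (c1, p)" "pass R (u, c1) = (b1, q)"
    and "braid_at (pass R) q p w2"
  shows "braid_at (pass R) u v (w1 @ w2)"
proof -
  obtain v' u' where a: "pass R (u, v) = (v', u')" by force
  obtain a1 u1 where b: "pass R (u', w1) = (a1, u1)" by force
  obtain b1' v1 where c: "pass R (v', a1) = (b1', v1)" by force
  have 1: "pass R (v', a1) = (b1, v1)" "pass R (q, p) = (v1, u1)"
    using braid_atE[OF assms(1) a b c] assms(2,3) c by (metis prod.inject)+
  obtain a2 u2 where d: "pass R (u1, w2) = (a2, u2)" by force
  obtain b2 v2 where e: "pass R (v1, a2) = (b2, v2)" by force
  obtain c2 r s where 2: "pass R (p, w2) = (c2, r)" "pass R (q, c2) = (b2, s)"
      "pass R (s, r) = (v2, u2)"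
    using braid_atE[OF assms(4) 1(2) d e] by metis
  show ?thesis
    by (rule braid_atI[OF a pass_append_right[OF b d] pass_append_right[OF 1(1) e]
          pass_append_right[OF assms(2) 2(1)] pass_append_right[OF assms(3) 2(2)] 2(3)])
qed

text \<open>Passing preserves lengths, so both parts of a cut diagram have fewer strands than the whole
  one, although their words are not subwords of the given ones.\<close>

lemma braid_at_pass:
  assumes R: "R \<in> X \<times> X \<rightarrow> X \<times> X"
    and letters: "\<And>x y z. x \<in> X \<Longrightarrow> y \<in> X \<Longrightarrow> z \<in> X \<Longrightarrow> braid_at R x y z"
    and "u \<in> nlists l X" "v \<in> nlists m X" "w \<in> nlists n X"
  shows "braid_at (pass R) u v w"
  using assms(3-5)
proof (induction "l + m + n" arbitrary: l m n u v w rule: less_induct)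
  case less
  note closed = pass_nlists[OF R]
  have long: "\<exists>x s'. s = [x] @ s' \<and> [x] \<in> nlists 1 X \<and> s' \<in> nlists (k - 1) X"
    if "s \<in> nlists k X" "k \<ge> 2" for s k
    using that by (cases s) (auto simp: nlists_def)
  consider "l = 0" | "m = 0" | "n = 0" | "l \<ge> 2" | "m \<ge> 2" | "n \<ge> 2" | "l = 1" "m = 1" "n = 1"
    by arith
  then show ?case
  proof cases
    case 1
    then have "u = []" using less.prems by simp
    then show ?thesis by (simp add: braid_at_def R12_def R23_def split: prod.split)
  next
    case 2
    then have "v = []" using less.prems by simp
    then show ?thesis by (simp add: braid_at_def R12_def R23_def split: prod.split)
  next
    case 3
    then have "w = []" using less.prems by simp
    then show ?thesis by (simp add: braid_at_def R12_def R23_def split: prod.split)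
  next
    case 4
    obtain x u2 where u: "u = [x] @ u2" "[x] \<in> nlists 1 X" "u2 \<in> nlists (l - 1) X"
      using long[OF less.prems(1) 4] by metis
    obtain v1 u2' where a: "pass R (u2, v) = (v1, u2')" by force
    obtain w1 u2'' where b: "pass R (u2', w) = (w1, u2'')" by force
    note A = closed[OF u(3) less.prems(2) a]
    note B = closed[OF A(2) less.prems(3) b]
    have 1: "braid_at (pass R) u2 v w"
      using 4 by (intro less.hyps[OF _ u(3) less.prems(2,3)]) linarith
    have 2: "braid_at (pass R) [x] v1 w1"
      using 4 by (intro less.hyps[OF _ u(2) A(1) B(1)]) linarith
    show ?thesis
      unfolding u(1) by (rule braid_at_append_left[OF 1 a b 2])
  next
    case 5
    obtain y v2 where v: "v = [y] @ v2" "[y] \<in> nlists 1 X" "v2 \<in> nlists (m - 1) X"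
      using long[OF less.prems(2) 5] by metis
    obtain v1' u' where a: "pass R (u, [y]) = (v1', u')" by force
    obtain wa va where b: "pass R (v2, w) = (wa, va)" by force
    note A = closed[OF less.prems(1) v(2) a]
    note B = closed[OF v(3) less.prems(3) b]
    have 1: "braid_at (pass R) u' v2 w"
      using 5 by (intro less.hyps[OF _ A(2) v(3) less.prems(3)]) linarith
    have 2: "braid_at (pass R) u [y] wa"
      using 5 by (intro less.hyps[OF _ less.prems(1) v(2) B(1)]) linarith
    show ?thesis
      unfolding v(1) by (rule braid_at_append_middle[OF a 1 b 2])
  next
    case 6
    obtain z w2 where w: "w = [z] @ w2" "[z] \<in> nlists 1 X" "w2 \<in> nlists (n - 1) X"
      using long[OF less.prems(3) 6] by metis
    obtain c1 p where a: "pass R (v, [z]) = (c1, p)" by force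
    obtain b1 q where b: "pass R (u, c1) = (b1, q)" by force
    note A = closed[OF less.prems(2) w(2) a]
    note B = closed[OF less.prems(1) A(1) b]
    have 1: "braid_at (pass R) u v [z]"
      using 6 by (intro less.hyps[OF _ less.prems(1,2) w(2)]) linarith
    have 2: "braid_at (pass R) q p w2"
      using 6 by (intro less.hyps[OF _ B(2) A(2) w(3)]) linarith
    show ?thesis
      unfolding w(1) by (rule braid_at_append_right[OF 1 a b 2])
  next
    case 7
    then obtain x y z where "u = [x]" "v = [y]" "w = [z]" "x \<in> X" "y \<in> X" "z \<in> X"
      using less.prems by (auto simp: in_nlists_Suc_iff)
    then show ?thesis by (simp add: braid_at_pass_singletons letters)
  qed
qed

section \<open>Levels\<close>

lemma comp_list_simps [simp]:
  "comp_list [] = id" "comp_list (f # fs) = f \<circ> comp_list fs"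
  by (simp_all add: comp_list_def)

lemma comp_list_append [simp]: "comp_list (fs @ gs) = comp_list fs \<circ> comp_list gs"
  by (induction fs) (simp_all add: o_assoc)

lemma level_factor_eq_move:
  assumes "k \<ge> 1" "length p = k - 1" "move R x v = (v', x')"
  shows "level_factor R (length v) k (p @ x # v @ s) = p @ v' @ x' # s"
  using assms
proof (induction v arbitrary: k p x v')
  case Nil
  then show ?case by (simp add: level_factor_def)
next
  case (Cons y v)
  obtain a b where R: "R (x, y) = (a, b)" by force
  with Cons.prems(3) obtain v'' where m: "move R b v = (v'', x')" "v' = a # v''"
    by (auto split: prod.splits)
  \<comment> \<open>The rightmost factor of the bracket acts first and lets \<open>x\<close> cross the first letter of the word.\<close>
  have "level_factor R (length (y # v)) k = level_factor R (length v) (Suc k) \<circ> adj R k"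
    by (simp add: level_factor_def upt_conv_Cons del: upt_Suc)
  moreover have "adj R k (p @ x # (y # v) @ s) = (p @ [a]) @ b # v @ s"
    using Cons.prems(1,2) R by (cases k) (auto simp: adj_def nth_append list_update_append)
  moreover have "level_factor R (length v) (Suc k) ((p @ [a]) @ b # v @ s)
      = (p @ [a]) @ v'' @ x' # s"
    using Cons.prems(1,2) m by (intro Cons.IH) auto
  ultimately show ?case using m by simp
qed

lemma comp_list_level_factors_eq_pass:
  assumes "length v = n" "pass R (u, v) = (v', u')"
  shows "comp_list (map (level_factor R n) [1..<Suc (length u)]) (u @ v @ s) = v' @ u' @ s"
  using assms
proof (induction u arbitrary: v v' u' s rule: rev_induct)
  case Nil
  then show ?case by simp
next
  case (snoc x u)
  obtain v1 x' where m: "move R x v = (v1, x')" by force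
  obtain v2 u1 where p: "pass R (u, v1) = (v2, u1)" by force
  have x: "pass R ([x], v) = (v1, [x'])" using m by simp
  have eq: "v' = v2" "u' = u1 @ [x']"
    using pass_append_left[OF x p] snoc.prems(2) by simp_all
  have len: "length v1 = n"
    using pass_lengths(1)[OF x] snoc.prems(1) by simp
  have "level_factor R n (Suc (length u)) (u @ x # v @ s) = u @ v1 @ x' # s"
    using level_factor_eq_move[of "Suc (length u)" u R x v v1 x' s] m snoc.prems(1) by simp
  moreover have "comp_list (map (level_factor R n) [1..<Suc (length u)]) (u @ v1 @ (x' # s))
      = v2 @ u1 @ (x' # s)"
    by (rule snoc.IH[OF len p])
  ultimately show ?case by (simp add: eq)
qed

lemma level_eq_pass:
  assumes "length u = n" "length v = n"
  shows "level R n (u, v) = pass R (u, v)"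
proof -
  obtain v' u' where p: "pass R (u, v) = (v', u')" by force
  have "length v' = n"
    using pass_lengths(1)[OF p] assms(2) by simp
  moreover have "comp_list (map (level_factor R n) [1..<Suc n]) (u @ v) = v' @ u'"
    using comp_list_level_factors_eq_pass[OF assms(2) p, of "[]"] assms(1) by simp
  ultimately show ?thesis by (simp add: level_def p del: upt_Suc)
qed

lemma level_eq_pass_on:
  "p \<in> nlists n X \<times> nlists n X \<Longrightarrow> level R n p = pass R p"
  by (auto simp: level_eq_pass nlists_def)

lemma pass_funcset:
  assumes "R \<in> X \<times> X \<rightarrow> X \<times> X"
  shows "pass R \<in> nlists n X \<times> nlists n X \<rightarrow> nlists n X \<times> nlists n X"
proof
  fix p assume "p \<in> nlists n X \<times> nlists n X"
  then obtain u v where p: "p = (u, v)" "u \<in> nlists n X" "v \<in> nlists n X" by blast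
  obtain v' u' where "pass R (u, v) = (v', u')" by force
  with pass_nlists[OF assms p(2,3) this] show "pass R p \<in> nlists n X \<times> nlists n X"
    using p(1) by simp
qed

lemma bij_betw_level:
  assumes "bij_betw R (X \<times> X) (X \<times> X)"
  shows "bij_betw (level R n) (nlists n X \<times> nlists n X) (nlists n X \<times> nlists n X)"
proof -
  define P where "P = inv_into (X \<times> X) R"
  have R: "R \<in> X \<times> X \<rightarrow> X \<times> X" and P: "P \<in> X \<times> X \<rightarrow> X \<times> X"
    using assms bij_betw_inv_into[OF assms] by (auto simp: P_def bij_betw_def)
  have inv: "P (R p) = p" "R (P p) = p" if "p \<in> X \<times> X" for p
    using assms that by (simp_all add: P_def bij_betw_inv_into_left bij_betw_inv_into_right)
  have "bij_betw (pass R) (nlists n X \<times> nlists n X) (nlists n X \<times> nlists n X)"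
  proof (rule bij_betw_byWitness[where f' = "pass P"])
    show "\<forall>p\<in>nlists n X \<times> nlists n X. pass P (pass R p) = p"
      using pass_left_inverse[OF R inv(1) nlists_imp_lists nlists_imp_lists] by auto
    show "\<forall>p\<in>nlists n X \<times> nlists n X. pass R (pass P p) = p"
      using pass_left_inverse[OF P inv(2) nlists_imp_lists nlists_imp_lists] by auto
  qed (use pass_funcset[OF R] pass_funcset[OF P] in blast)+
  then show ?thesis
    by (simp add: level_eq_pass_on cong: bij_betw_cong)
qed

lemma YBE_solution_level:
  assumes "YBE_solution X R"
  shows "YBE_solution (nlists n X) (level R n)"
proof -
  have bij: "bij_betw R (X \<times> X) (X \<times> X)"
    and braid: "\<And>x y z. x \<in> X \<Longrightarrow> y \<in> X \<Longrightarrow> z \<in> X \<Longrightarrow> braid_at R x y z"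
    using assms by (auto simp: YBE_solution_iff_braid_at)
  have R: "R \<in> X \<times> X \<rightarrow> X \<times> X"
    using bij by (rule bij_betw_imp_funcset)
  show ?thesis
    using bij_betw_level[OF bij] braid_at_pass[OF R braid]
      braid_at_cong[OF pass_funcset[OF R] level_eq_pass_on]
    by (simp add: YBE_solution_iff_braid_at)
qed

lemma YBE_solution_if_level_1:
  assumes bij: "bij_betw R (X \<times> X) (X \<times> X)" and "YBE_solution (nlists 1 X) (level R 1)"
  shows "YBE_solution X R"
proof -
  have R: "R \<in> X \<times> X \<rightarrow> X \<times> X"
    using bij by (rule bij_betw_imp_funcset)
  have "braid_at R x y z" if "x \<in> X" "y \<in> X" "z \<in> X" for x y z
  proof -
    have words: "[x] \<in> nlists 1 X" "[y] \<in> nlists 1 X" "[z] \<in> nlists 1 X"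
      using that by (simp_all add: nlists_def)
    then have "braid_at (level R 1) [x] [y] [z]"
      using assms(2) by (simp add: YBE_solution_iff_braid_at)
    then show ?thesis
      using braid_at_cong[OF pass_funcset[OF R] level_eq_pass_on words]
      by (simp add: braid_at_pass_singletons)
  qed
  with bij show ?thesis by (simp add: YBE_solution_iff_braid_at)
qed

lemma involutive_on_level:
  assumes "R \<in> X \<times> X \<rightarrow> X \<times> X" "involutive_on X R"
  shows "involutive_on (nlists n X) (level R n)"
  unfolding involutive_on_def
proof
  fix p assume p: "p \<in> nlists n X \<times> nlists n X"
  have "R (R q) = q" if "q \<in> X \<times> X" for q
    using assms(2) that unfolding involutive_on_def by blast
  from p pass_left_inverse[OF assms(1) this nlists_imp_lists nlists_imp_lists]
  have "pass R (pass R p) = p" by auto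
  then show "level R n (level R n p) = p"
    using p funcset_mem[OF pass_funcset[OF assms(1)] p] by (simp add: level_eq_pass_on)
qed

text \<open>A map of the form \<open>(x, y) \<mapsto> (\<beta>\<^sub>x(y), x)\<close> is one that keeps \<open>x\<close>: the
  maps \<open>\<beta>\<^sub>x\<close> can then be read off from the other component.  Likewise for \<open>y\<close>.\<close>

lemma derived_type_iff:
  "derived_type X R \<longleftrightarrow> YBE_solution X R \<and>
     ((\<forall>x\<in>X. \<forall>y\<in>X. snd (R (x, y)) = x) \<or> (\<forall>x\<in>X. \<forall>y\<in>X. fst (R (x, y)) = y))"
  (is "_ \<longleftrightarrow> _ \<and> (?keeps_left \<or> ?keeps_right)")
proof (intro iffI conjI)
  assume D: "derived_type X R"
  then show "YBE_solution X R" by (simp add: derived_type_def)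
  from D show "?keeps_left \<or> ?keeps_right"
    unfolding derived_type_def by fastforce
next
  assume *: "YBE_solution X R \<and> (?keeps_left \<or> ?keeps_right)"
  then have R: "R \<in> X \<times> X \<rightarrow> X \<times> X"
    unfolding YBE_solution_def using bij_betw_imp_funcset by blast
  then have mem: "fst (R (x, y)) \<in> X" "snd (R (x, y)) \<in> X" if "x \<in> X" "y \<in> X" for x y
    using funcset_mem[OF R, of "(x, y)"] that by (simp_all add: mem_Times_iff)
  from * have "?keeps_left \<or> ?keeps_right" by simp
  then have "\<exists>\<beta> \<in> X \<rightarrow> X \<rightarrow> X.
        (\<forall>x\<in>X. \<forall>y\<in>X. R (x, y) = (\<beta> x y, x)) \<or> (\<forall>x\<in>X. \<forall>y\<in>X. R (x, y) = (y, \<beta> y x))"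
  proof
    assume ?keeps_left
    then show ?thesis
      using mem by (intro bexI[of _ "\<lambda>x y. fst (R (x, y))"] disjI1) (auto simp: prod_eq_iff)
  next
    assume ?keeps_right
    then show ?thesis
      using mem by (intro bexI[of _ "\<lambda>y x. snd (R (x, y))"] disjI2) (auto simp: prod_eq_iff)
  qed
  with * show "derived_type X R" by (simp add: derived_type_def)
qed

lemma derived_type_level:
  assumes "derived_type X R"
  shows "derived_type (nlists n X) (level R n)"
proof -
  have R: "R \<in> X \<times> X \<rightarrow> X \<times> X"
    using assms bij_betw_imp_funcset unfolding derived_type_def YBE_solution_def by blast
  have YBE: "YBE_solution (nlists n X) (level R n)"
    using assms by (simp add: derived_type_def YBE_solution_level)
  from assms consider
      "\<And>x y. x \<in> X \<Longrightarrow> y \<in> X \<Longrightarrow> snd (R (x, y)) = x"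
    | "\<And>x y. x \<in> X \<Longrightarrow> y \<in> X \<Longrightarrow> fst (R (x, y)) = y"
    unfolding derived_type_iff by blast
  then show ?thesis
  proof cases
    case 1
    have "snd (level R n (u, v)) = u" if "u \<in> nlists n X" "v \<in> nlists n X" for u v
      using pass_keeps_left[OF R 1 that[THEN nlists_imp_lists]] that
      by (simp add: level_eq_pass_on[where X = X])
    with YBE show ?thesis by (simp add: derived_type_iff)
  next
    case 2
    have "fst (level R n (u, v)) = v" if "u \<in> nlists n X" "v \<in> nlists n X" for u v
      using pass_keeps_right[OF R 2 that[THEN nlists_imp_lists]] that
      by (simp add: level_eq_pass_on[where X = X])
    with YBE show ?thesis by (simp add: derived_type_iff)
  qed
qed

theorem theorem4p5:
  fixes N :: nat and R :: "nat \<times> nat \<Rightarrow> nat \<times> nat"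
  assumes "N \<ge> 1"
    and "bij_betw R ({1..N} \<times> {1..N}) ({1..N} \<times> {1..N})"
  shows
    "(YBE_solution {1..N} R \<longleftrightarrow> (\<forall>n\<ge>1. YBE_solution (nlists n {1..N}) (level R n))) \<and>
     (involutive_on {1..N} R \<longrightarrow> (\<forall>n\<ge>1. involutive_on (nlists n {1..N}) (level R n))) \<and>
     (derived_type {1..N} R \<longrightarrow> (\<forall>n\<ge>1. derived_type (nlists n {1..N}) (level R n)))"
proof (intro conjI iffI impI allI)
  show "YBE_solution {1..N} R" if "\<forall>n\<ge>1. YBE_solution (nlists n {1..N}) (level R n)"
    using that by (intro YBE_solution_if_level_1[OF assms(2)]) simp
  show "involutive_on (nlists n {1..N}) (level R n)" if "involutive_on {1..N} R" for n
    using bij_betw_imp_funcset[OF assms(2)] that by (rule involutive_on_level)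
qed (rule YBE_solution_level derived_type_level, assumption)+

end
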